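(* There exists an infinite word $\mathbf{b}=b_0b_1b_2\cdots$ over the alphabet $\{-1,+1\}$ such that $$C(\mathbf{b};m,k,N)\le 4\sqrt{(m+k+N)\log(m+k+N)}$$ for all integers $m\ge 0$, $k\ge 1$, $N\ge 1$.
   Context: For an infinite word $\mathbf{b}=b_0b_1\cdots$ over $\{-1,+1\}$ and integers $m\ge0$, $k\ge1$, $N\ge1$, set $C(\mathbf{b};m,k,N)=\left|\sum_{i=m}^{m+N-1}b_ib_{i+k}\right|$. Here $\log$ is the natural logarithm. *)

theory Defs
  imports Complex_Main
begin

definition pm_word :: "(nat \<Rightarrow> int) \<Rightarrow> bool" where
  "pm_word b \<longleftrightarrow> range b \<subseteq> {-1, 1}"

(* The half-open range is i = m, ..., m + N - 1; it avoids truncated subtraction on nat. *)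
definition C :: "(nat \<Rightarrow> int) \<Rightarrow> nat \<Rightarrow> nat \<Rightarrow> nat \<Rightarrow> int" where
  "C b m k N = \<bar>\<Sum>i = m..<m + N. b i * b (i + k)\<bar>"

end

theory Submission
  imports Defs
begin

text \<open>
  For a uniformly random word and fixed \<open>k\<close>, the products \<open>b\<^sub>i b\<^sub>i\<^sub>+\<^sub>k\<close> are independent uniform
  signs, so an exponential moment bound shows that the autocorrelation sum of a triple with
  \<open>m + k + N = M\<close> exceeds the bound with probability at most \<open>2 / M\<^sup>4\<close>. There are
  \<open>M (M - 1) / 2\<close> such triples, and \<open>\<Sum>\<^sub>M\<^sub>\<ge>\<^sub>2 M\<^sup>-\<^sup>2 < 1\<close>; hence for every \<open>L\<close> some word satisfies
  all constraints with \<open>M \<le> L\<close>. Each constraint involves only finitely many letters, so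
  Koenig's lemma yields a single infinite word.
\<close>

section \<open>Signed autocorrelation sums\<close>

definition autocorr :: "(nat \<Rightarrow> int) \<Rightarrow> nat \<Rightarrow> nat \<Rightarrow> nat \<Rightarrow> int" where
  "autocorr b m k N = (\<Sum>i = m..<m + N. b i * b (i + k))"

lemma autocorr_0 [simp]: "autocorr b m k 0 = 0"
  by (simp add: autocorr_def)

lemma autocorr_Suc:
  "autocorr b m k (Suc N) = autocorr b m k N + b (m + N) * b (m + N + k)"
  by (simp add: autocorr_def)

lemma autocorr_cong:
  assumes "\<And>i. i < m + k + N \<Longrightarrow> b i = b' i"
  shows "autocorr b m k N = autocorr b' m k N"
  unfolding autocorr_def using assms by (intro sum.cong) auto

lemma C_eq_abs_autocorr: "C b m k N = \<bar>autocorr b m k N\<bar>"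
  by (simp add: C_def autocorr_def)

section \<open>Averages over finite random words\<close>

text \<open>The mean of a function over the \<open>2\<^sup>n\<close> words whose first \<open>n\<close> letters are arbitrary
  signs and whose remaining letters are \<open>1\<close>.\<close>
primrec word_avg :: "nat \<Rightarrow> ((nat \<Rightarrow> int) \<Rightarrow> real) \<Rightarrow> real" where
  "word_avg 0 F = F (\<lambda>_. 1)"
| "word_avg (Suc n) F =
     (word_avg n (\<lambda>b. F (b(n := 1))) + word_avg n (\<lambda>b. F (b(n := -1)))) / 2"

lemma pm_word_upd: "pm_word b \<Longrightarrow> x \<in> {-1, 1} \<Longrightarrow> pm_word (b(n := x))"
  by (auto simp: pm_word_def)

lemma pm_word_cases: "pm_word b \<Longrightarrow> b i = -1 \<or> b i = 1"
  by (auto simp: pm_word_def)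

text \<open>The average evaluates only words obtained from the constant 1 by sign updates, so
  agreement on sign words is enough. The \<open>cosh\<close> identity below holds only for such
  words.\<close>

lemma word_avg_cong:
  assumes "\<And>b. pm_word b \<Longrightarrow> F b = G b"
  shows "word_avg n F = word_avg n G"
  using assms
proof (induction n arbitrary: F G)
  case 0
  then show ?case by (simp add: pm_word_def)
next
  case (Suc n)
  have "word_avg n (\<lambda>b. F (b(n := x))) = word_avg n (\<lambda>b. G (b(n := x)))"
    if "x \<in> {-1, 1}" for x
    by (rule Suc.IH) (use that Suc.prems in \<open>blast intro: pm_word_upd\<close>)
  then show ?case by simp
qed

lemma word_avg_mult: "word_avg n (\<lambda>b. c * F b) = c * word_avg n F"
  by (induction n arbitrary: F) (simp_all add: algebra_simps)

lemma word_avg_add: "word_avg n (\<lambda>b. F b + G b) = word_avg n F + word_avg n G"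
  by (induction n arbitrary: F G) (simp_all add: field_simps)

lemma word_avg_const: "word_avg n (\<lambda>_. c) = c"
  by (induction n) simp_all

lemma word_avg_sum: "word_avg n (\<lambda>b. \<Sum>i\<in>I. F i b) = (\<Sum>i\<in>I. word_avg n (F i))"
  by (induction I rule: infinite_finite_induct) (simp_all add: word_avg_add word_avg_const)

text \<open>First-moment principle: if the mean of two halves is below \<open>c\<close>, so is one
  of them, and the induction fixes one letter at a time.\<close>

lemma word_avg_less_imp_ex:
  assumes "word_avg n F < c"
  shows "\<exists>b. pm_word b \<and> F b < c"
  using assms
proof (induction n arbitrary: F)
  case 0
  then show ?case by (auto simp: pm_word_def)
next
  case (Suc n)
  then consider "word_avg n (\<lambda>b. F (b(n := 1))) < c" | "word_avg n (\<lambda>b. F (b(n := -1))) < c"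
    by fastforce
  then show ?case
  proof cases
    case 1
    from Suc.IH[OF this] show ?thesis by (blast intro: pm_word_upd)
  next
    case 2
    from Suc.IH[OF this] show ?thesis by (blast intro: pm_word_upd)
  qed
qed

text \<open>The letter with index \<open>m + k + N - 1\<close> occurs only in the last product, so averaging
  over it splits off a factor \<^term>\<open>cosh l\<close>, whatever the earlier letters are.\<close>
lemma word_avg_exp_autocorr:
  fixes l :: real
  assumes "m + k + N \<le> n" "1 \<le> k"
  shows "word_avg n (\<lambda>b. exp (l * real_of_int (autocorr b m k N))) = cosh l ^ N"
  using assms
proof (induction n arbitrary: N)
  case 0
  then show ?case by simp
next
  case (Suc n)
  show ?case
  proof (cases "m + k + N \<le> n")
    case True
    then have "autocorr (b(n := x)) m k N = autocorr b m k N" for b x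
      by (intro autocorr_cong) auto
    with Suc.IH[OF True] Suc.prems show ?thesis by simp
  next
    case False
    show ?thesis
    proof (cases N)
      case 0
      then show ?thesis by (simp add: word_avg_const)
    next
      case (Suc N')
      with False Suc.prems have n: "n = m + N' + k" by simp
      let ?E = "\<lambda>b. exp (l * real_of_int (autocorr b m k N'))"
      have prefix: "autocorr (b(n := x)) m k N' = autocorr b m k N'" for b x
        using n by (intro autocorr_cong) auto
      have avg: "(exp (l * real_of_int (autocorr (b(n := 1)) m k N)) +
             exp (l * real_of_int (autocorr (b(n := -1)) m k N))) / 2 = cosh l * ?E b"
        if "pm_word b" for b
      proof -
        \<comment> \<open>Since \<open>1 \<le> k\<close>, the partner of the last letter in the
          product is an earlier letter, untouched by the update. Its sign is irrelevant because
          \<open>cosh\<close> is even.\<close>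
        have "m + N' \<noteq> n" using n Suc.prems by simp
        then have eq: "autocorr (b(n := x)) m k N = autocorr b m k N' + b (m + N') * x" for x
          unfolding Suc autocorr_Suc prefix using n by simp
        show ?thesis unfolding eq using pm_word_cases[OF that, of "m + N'"]
          by (auto simp: exp_add exp_diff cosh_def exp_minus field_simps)
      qed
      have "word_avg (Suc n) (\<lambda>b. exp (l * real_of_int (autocorr b m k N))) =
          word_avg n (\<lambda>b. (1 / 2) * (exp (l * real_of_int (autocorr (b(n := 1)) m k N)) +
             exp (l * real_of_int (autocorr (b(n := -1)) m k N))))"
        by (simp only: word_avg_mult word_avg_add word_avg.simps)
      also have "\<dots> = word_avg n (\<lambda>b. cosh l * ?E b)"
        by (rule word_avg_cong) (use avg in simp)
      also have "\<dots> = cosh l * cosh l ^ N'"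
        using Suc.IH[of N'] n Suc.prems by (simp add: word_avg_mult)
      finally show ?thesis by (simp add: Suc)
    qed
  qed
qed

section \<open>Exponential tail bounds\<close>

lemma cosh_le_exp_square: "cosh x \<le> exp (x\<^sup>2)" for x :: real
proof -
  have nonneg: "cosh x \<le> exp (x\<^sup>2)" if "0 \<le> x" for x :: real
  proof (cases "x \<le> 1")
    case True
    have up: "exp x \<le> 1 + x + x\<^sup>2"
      using exp_bound that True by blast
    \<comment> \<open>The product is 1 + x^3; with 1 + x \<le> \<open>exp x\<close> this gives the
      quadratic bound on \<open>exp (- x)\<close>.\<close>
    have "1 \<le> (1 - x + x\<^sup>2) * (1 + x)"
      using that by (simp add: algebra_simps power2_eq_square)
    also have "\<dots> \<le> (1 - x + x\<^sup>2) * exp x"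
    proof (rule mult_left_mono)
      show "0 \<le> 1 - x + x\<^sup>2" using True zero_le_power2[of x] by linarith
    qed (rule exp_ge_add_one_self)
    finally have down: "exp (- x) \<le> 1 - x + x\<^sup>2"
      by (simp add: exp_minus field_simps)
    have "cosh x \<le> 1 + x\<^sup>2"
      using up down by (simp add: cosh_def)
    also have "\<dots> \<le> exp (x\<^sup>2)" by (rule exp_ge_add_one_self)
    finally show ?thesis .
  next
    case False
    have "exp (- x) \<le> exp x" using that by simp
    then have "cosh x \<le> exp x" by (simp add: cosh_def)
    also have "\<dots> \<le> exp (x\<^sup>2)"
      using False by (simp add: power2_eq_square)
    finally show ?thesis .
  qed
  show ?thesis
    using nonneg[of x] nonneg[of "- x"] by (cases "0 \<le> x") auto
qed

definition bound :: "nat \<Rightarrow> real" where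
  "bound M = 4 * sqrt (real M * ln (real M))"

text \<open>The parameter of the exponential moment that minimises
  \<^term>\<open>exp (M * l\<^sup>2 - l * bound M)\<close>.\<close>
definition rate :: "nat \<Rightarrow> real" where
  "rate M = 2 * sqrt (ln (real M) / real M)"

lemma rate_pos: "2 \<le> M \<Longrightarrow> 0 < rate M"
  by (simp add: rate_def)

lemma rate_square: "1 \<le> M \<Longrightarrow> real M * (rate M)\<^sup>2 = 4 * ln (real M)"
  by (simp add: rate_def power_mult_distrib)

lemma rate_mult_bound: "1 \<le> M \<Longrightarrow> rate M * bound M = 8 * ln (real M)"
  by (simp add: rate_def bound_def real_sqrt_mult real_sqrt_divide)

lemma word_avg_tail:
  assumes "m + k + N \<le> n" "1 \<le> k" "2 \<le> M" "N \<le> M" "\<bar>l\<bar> = rate M"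
  shows "word_avg n (\<lambda>b. exp (l * real_of_int (autocorr b m k N) - rate M * bound M))
           \<le> 1 / real M ^ 4"
proof -
  have "cosh l ^ N \<le> cosh l ^ M"
    using assms(4) by (intro power_increasing) (simp_all add: cosh_real_ge_1)
  also have "\<dots> \<le> exp (l\<^sup>2) ^ M"
    by (intro power_mono cosh_le_exp_square) (simp add: less_imp_le)
  also have "\<dots> = exp (real M * (rate M)\<^sup>2)"
    by (simp add: exp_of_nat_mult flip: assms(5))
  also have "\<dots> = exp (4 * ln (real M))"
    using assms(3) by (simp add: rate_square)
  finally have 1: "cosh l ^ N \<le> exp (4 * ln (real M))" .
  have "word_avg n (\<lambda>b. exp (l * real_of_int (autocorr b m k N) - rate M * bound M)) =
      exp (- (8 * ln (real M))) * cosh l ^ N"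
    using assms
    by (simp add: rate_mult_bound exp_add word_avg_mult word_avg_exp_autocorr
          flip: uminus_add_conv_diff)
  also have "\<dots> \<le> exp (- (8 * ln (real M))) * exp (4 * ln (real M))"
    by (intro mult_left_mono 1) simp
  also have "\<dots> = exp (- (real 4 * ln (real M)))"
    by (simp flip: exp_add)
  also have "\<dots> = 1 / real M ^ 4"
    unfolding exp_minus exp_of_nat_mult using assms(3) by (simp add: divide_inverse)
  finally show ?thesis .
qed

section \<open>Union bound over all constraints up to a level\<close>

definition good :: "nat \<Rightarrow> (nat \<Rightarrow> int) \<Rightarrow> bool" where
  "good L b \<longleftrightarrow> pm_word b \<and> (\<forall>m k N. 1 \<le> k \<longrightarrow> 1 \<le> N \<longrightarrow> m + k + N \<le> L \<longrightarrow>
     real_of_int (C b m k N) \<le> bound (m + k + N))"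

text \<open>Telescoping: 1/(n+1)^2 \<le> 1/n - 1/(n+1).\<close>

lemma sum_inverse_squares: "(\<Sum>M = 2..L. 1 / (real M)\<^sup>2) < 1"
proof -
  have "(\<Sum>M = 2..L. 1 / (real M)\<^sup>2) \<le> 1 - 1 / real L" if "1 \<le> L"
    using that
  proof (induction L rule: dec_induct)
    case (step n)
    have "(\<Sum>M = 2..Suc n. 1 / (real M)\<^sup>2) = (\<Sum>M = 2..n. 1 / (real M)\<^sup>2) + 1 / (real (Suc n))\<^sup>2"
      using step by simp
    also have "\<dots> \<le> 1 - 1 / real n + 1 / (real n * real (Suc n))"
      using step by (intro add_mono divide_left_mono) (auto simp: power2_eq_square intro!: mult_mono)
    also have "\<dots> = 1 - 1 / real (Suc n)"
      using step by (simp add: divide_simps) (simp add: algebra_simps)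
    finally show ?case .
  qed simp
  then show ?thesis
    by (cases "L = 0") (auto intro: le_less_trans)
qed

lemma ex_good: "\<exists>b. good L b"
proof -
  define e where "e = (\<lambda>l m k N (b :: nat \<Rightarrow> int).
    exp (l * real_of_int (autocorr b m k N) - rate (m + k + N) * bound (m + k + N)))"
  \<comment> \<open>Triples are indexed by their total \<open>M\<close>;
    \<open>N \<le> M - k\<close> ensures that \<open>m = M - k - N\<close> is not truncated.\<close>
  define T where "T = (SIGMA M:{2..L}. SIGMA k:{1..<M}. {1..M - k})"
  \<comment> \<open>A violated constraint would make one of its two terms exceed 1, and all terms
    are positive, so \<open>F b < 1\<close> excludes every violation.\<close>
  define F where "F = (\<lambda>b. \<Sum>(M, k, N)\<in>T.
     e (rate M) (M - k - N) k N b + e (- rate M) (M - k - N) k N b)"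
  have fin: "finite T" by (simp add: T_def)
  have "word_avg L F = (\<Sum>(M, k, N)\<in>T. word_avg L (e (rate M) (M - k - N) k N)
      + word_avg L (e (- rate M) (M - k - N) k N))"
    unfolding F_def word_avg_sum by (intro sum.cong refl) (auto simp: word_avg_add)
  also have "\<dots> \<le> (\<Sum>(M, k, N)\<in>T. 2 / real M ^ 4)"
  proof (rule sum_mono, clarify)
    fix M k N assume t: "(M, k, N) \<in> T"
    have "word_avg L (e l (M - k - N) k N) \<le> 1 / real M ^ 4" if "\<bar>l\<bar> = rate M" for l
    proof -
      from t have "M - k - N + k + N = M" by (auto simp: T_def)
      then show ?thesis
        unfolding e_def using word_avg_tail[of "M - k - N" k N L M l] t that
        by (auto simp: T_def)
    qed
    from this[of "rate M"] this[of "- rate M"] t rate_pos[of M]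
    show "word_avg L (e (rate M) (M - k - N) k N) + word_avg L (e (- rate M) (M - k - N) k N)
      \<le> 2 / real M ^ 4" by (auto simp: T_def)
  qed
  also have "\<dots> = (\<Sum>M = 2..L. \<Sum>k = 1..<M. \<Sum>N = 1..M - k. 2 / real M ^ 4)"
    unfolding T_def
    by (simp only: sum.Sigma[symmetric] finite_SigmaI finite_atLeastAtMost
        finite_atLeastLessThan ball_triv simp_thms)
  also have "\<dots> \<le> (\<Sum>M = 2..L. 1 / (real M)\<^sup>2)"
  proof (rule sum_mono)
    fix M assume "M \<in> {2..L}"
    \<comment> \<open>This counts the triples with total \<open>M\<close>.\<close>
    have pairs: "(\<Sum>k = 1..<M. real (M - k)) = real M * (real M - 1) / 2"
    proof -
      have "(\<Sum>k = 1..<M. real (M - k)) = (\<Sum>k = 1..<M. real k)"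
        by (rule sum.reindex_bij_witness[where i = "\<lambda>k. M - k" and j = "\<lambda>k. M - k"]) auto
      also have "\<dots> = real M * (real M - 1) / 2"
        by (induction M) (auto simp: field_simps sum.atLeastLessThan_Suc)
      finally show ?thesis .
    qed
    have "(\<Sum>k = 1..<M. \<Sum>N = 1..M - k. 2 / real M ^ 4) =
        (\<Sum>k = 1..<M. real (M - k) * (2 / real M ^ 4))"
      by simp
    also have "\<dots> = (\<Sum>k = 1..<M. real (M - k)) * (2 / real M ^ 4)"
      by (rule sum_distrib_right [symmetric])
    also have "\<dots> = real M * (real M - 1) / real M ^ 4"
      unfolding pairs by simp
    also have "\<dots> \<le> (real M)\<^sup>2 / real M ^ 4"
      by (intro divide_right_mono) (auto simp: power2_eq_square algebra_simps)
    also have "\<dots> = 1 / (real M)\<^sup>2"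
      by (simp add: power2_eq_square power4_eq_xxxx)
    finally show "(\<Sum>k = 1..<M. \<Sum>N = 1..M - k. 2 / real M ^ 4) \<le> 1 / (real M)\<^sup>2" .
  qed
  also have "\<dots> < 1" by (rule sum_inverse_squares)
  finally obtain b where b: "pm_word b" "F b < 1"
    using word_avg_less_imp_ex by blast
  have "real_of_int (C b m k N) \<le> bound (m + k + N)"
    if "1 \<le> k" "1 \<le> N" "m + k + N \<le> L" for m k N
  proof -
    let ?M = "m + k + N"
    have "(?M, k, N) \<in> T" using that by (auto simp: T_def)
    then have "e (rate ?M) m k N b + e (- rate ?M) m k N b \<le> F b"
      unfolding F_def using fin member_le_sum[of "(?M, k, N)" T "\<lambda>(M, k, N).
        e (rate M) (M - k - N) k N b + e (- rate M) (M - k - N) k N b"]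
      by (auto simp: e_def add_nonneg_nonneg)
    with b(2) have "e (rate ?M) m k N b + e (- rate ?M) m k N b < 1" by simp
    moreover have "0 < e (rate ?M) m k N b" "0 < e (- rate ?M) m k N b"
      by (simp_all add: e_def)
    ultimately have "e (rate ?M) m k N b < 1" "e (- rate ?M) m k N b < 1" by linarith+
    then have "rate ?M * real_of_int (autocorr b m k N) < rate ?M * bound ?M"
      "rate ?M * (- real_of_int (autocorr b m k N)) < rate ?M * bound ?M"
      by (simp_all add: e_def)
    moreover have "0 < rate ?M" using that by (intro rate_pos) simp
    ultimately show ?thesis
      by (simp only: mult_less_cancel_left_pos C_eq_abs_autocorr)
  qed
  with b(1) show ?thesis by (auto simp: good_def)
qed

lemma good_antimono: "good L b \<Longrightarrow> L' \<le> L \<Longrightarrow> good L' b"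
  by (auto simp: good_def)

text \<open>Koenig's lemma for the binary tree of prefixes. The limit need not satisfy any
  \<open>P n\<close> itself; it only shares each finite prefix with a word that does.\<close>

lemma infinite_word_of_finite_approximations:
  fixes P :: "nat \<Rightarrow> (nat \<Rightarrow> int) \<Rightarrow> bool"
  assumes ex: "\<And>L. \<exists>b. P L b"
    and pm: "\<And>L b. P L b \<Longrightarrow> pm_word b"
    and anti: "\<And>L L' b. P L b \<Longrightarrow> L' \<le> L \<Longrightarrow> P L' b"
  shows "\<exists>b. pm_word b \<and> (\<forall>n. \<exists>b'. P n b' \<and> (\<forall>i<n. b' i = b i))"
proof -
  \<comment> \<open>The prefixes to keep are those that extend to a word of every level.\<close>
  define ext where "ext = (\<lambda>n w. \<forall>L. \<exists>b. P L b \<and> (\<forall>i<n. b i = w i))"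
  have step: "\<exists>x\<in>{-1, 1}. ext (Suc n) (w(n := x))" if w: "ext n w" for n and w :: "nat \<Rightarrow> int"
  proof (rule ccontr)
    assume "\<not> ?thesis"
    \<comment> \<open>If both one-letter extensions fail, a word of level \<open>max L1 L2\<close>
      extending \<open>w\<close> has no possible letter at \<open>n\<close>.\<close>
    then obtain L1 L2 where
      L1: "\<And>b. P L1 b \<Longrightarrow> \<not> (\<forall>i<Suc n. b i = (w(n := -1)) i)" and
      L2: "\<And>b. P L2 b \<Longrightarrow> \<not> (\<forall>i<Suc n. b i = (w(n := 1)) i)"
      unfolding ext_def by auto
    obtain b where b: "P (max L1 L2) b" "\<forall>i<n. b i = w i"
      using w unfolding ext_def by blast
    have "P L1 b" "P L2 b" using anti[OF b(1)] by simp_all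
    moreover have "b n = -1 \<or> b n = 1" using pm[OF b(1)] by (rule pm_word_cases)
    ultimately show False
      using L1[of b] L2[of b] b(2) by (auto simp: less_Suc_eq)
  qed
  have "\<exists>f. \<forall>n. ext n (f n) \<and> (\<exists>x\<in>{-1, 1}. f (Suc n) = (f n)(n := x))"
  proof (rule dependent_nat_choice)
    show "\<exists>w. ext 0 w" using ex by (simp add: ext_def)
  next
    fix w n assume "ext n w"
    then show "\<exists>v. ext (Suc n) v \<and> (\<exists>x\<in>{-1, 1}. v = w(n := x))"
      using step by blast
  qed
  then obtain f where f: "\<And>n. ext n (f n)" "\<And>n. \<exists>x\<in>{-1, 1}. f (Suc n) = (f n)(n := x)"
    by blast
  \<comment> \<open>Diagonal limit: letter \<open>i\<close> is fixed at stage \<open>i + 1\<close>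
    and never changed later.\<close>
  define b where "b = (\<lambda>i. f (Suc i) i)"
  have "b i = f n i" if "i < n" for i n
    using that
  proof (induction n)
    case (Suc n)
    then show ?case using f(2)[of n] by (cases "i = n") (auto simp: b_def)
  qed simp
  moreover have "b i \<in> {-1, 1}" for i
    using f(2)[of i] by (auto simp: b_def)
  ultimately show ?thesis
    using f(1) unfolding ext_def pm_word_def by (metis image_subsetI)
qed

theorem theorem3p3:
  shows "\<exists>b :: nat \<Rightarrow> int. pm_word b \<and>
    (\<forall>m k N :: nat. 1 \<le> k \<longrightarrow> 1 \<le> N \<longrightarrow>
      real_of_int (C b m k N) \<le> 4 * sqrt (real (m + k + N) * ln (real (m + k + N))))"
proof -
  obtain b where b: "pm_word b" "\<And>n. \<exists>b'. good n b' \<and> (\<forall>i<n. b' i = b i)"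
    using infinite_word_of_finite_approximations[of good] ex_good good_antimono good_def by metis
  have "real_of_int (C b m k N) \<le> bound (m + k + N)" if "1 \<le> k" "1 \<le> N" for m k N
  proof -
    \<comment> \<open>The level \<open>m + k + N\<close> includes this constraint, and the shared
      prefix contains every letter in it.\<close>
    obtain b' where b': "good (m + k + N) b'" "\<forall>i<m + k + N. b' i = b i"
      using b(2) by blast
    then have "autocorr b m k N = autocorr b' m k N"
      by (intro autocorr_cong) simp
    with b'(1) that show ?thesis
      by (auto simp: good_def C_eq_abs_autocorr)
  qed
  with b(1) show ?thesis
    unfolding bound_def by blast
qed

end
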